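(* There exists an absolute constant $C>0$ such that the following holds. Let $\mathrm d=(d_1,\ldots,d_n)$ be a degree sequence such that $n_1(\mathrm d)=n_2(\mathrm d)=0$ and such that $\mathcal C_{\mathrm d}$ is nonempty, and let $\mathbf G$ be a uniformly random element of $\mathcal C_{\mathrm d}$. Then $\mathbb E[\operatorname{diam}(\mathbf G)]\le C\log n$.
   Context: A degree sequence is a sequence $\mathrm d=(d_1,\dots,d_n)$ of positive integers with even sum. $n_b(\mathrm d)=|\{v\in[n]:d_v=b\}|$, where $[n]=\{1,\dots,n\}$. $\mathcal C_{\mathrm d}$ is the set of connected simple graphs $G$ with vertex set $[n]$ such that $\deg_G(v)=d_v$ for all $v\in[n]$. For a connected graph $G$, $\operatorname{diam}(G)=\max_{u,v\in V(G)}\operatorname{dist}_G(u,v)$, with $\operatorname{dist}_G$ the graph distance. *)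

theory Defs
  imports "HOL-Probability.Probability" "Graph_Theory.Graph_Theory"
begin

text \<open>
  Sequences \<open>(d\<^sub>1, \<dots>, d\<^sub>n)\<close> are functions on \<^typ>\<open>nat\<close>, of which only the values on
  \<open>{1..n}\<close> are ever used.
\<close>

definition degree_sequence :: "nat \<Rightarrow> (nat \<Rightarrow> nat) \<Rightarrow> bool" where
  "degree_sequence n d \<longleftrightarrow> (\<forall>v\<in>{1..n}. d v > 0) \<and> even (\<Sum>v\<in>{1..n}. d v)"

definition num_deg :: "nat \<Rightarrow> nat \<Rightarrow> (nat \<Rightarrow> nat) \<Rightarrow> nat" where
  "num_deg b n d = card {v \<in> {1..n}. d v = b}"

text \<open>
  The locale \<^locale>\<open>pair_graph\<close> describes finite simple undirected graphs: the arc set is a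
  symmetric, irreflexive relation on the vertex set, each edge \<open>uv\<close> being the two arcs
  \<open>(u, v)\<close> and \<open>(v, u)\<close>. Hence the degree of a vertex is its out-degree, a graph on \<open>{1..n}\<close>
  is represented by exactly one \<^typ>\<open>nat pair_pre_digraph\<close>, and the length of an arc walk is
  its number of edges. The library's notion of connectedness excludes the graph without vertices.
\<close>

definition connected_graphs :: "nat \<Rightarrow> (nat \<Rightarrow> nat) \<Rightarrow> nat pair_pre_digraph set" where
  "connected_graphs n d =
     {G. pair_graph G \<and> pverts G = {1..n} \<and> Digraph_Component.connected (with_proj G) \<and>
         (\<forall>v\<in>{1..n}. out_degree (with_proj G) v = d v)}"

text \<open>Only meaningful if \<open>v\<close> is reachable from \<open>u\<close>.\<close>

definition graph_dist :: "'a pair_pre_digraph \<Rightarrow> 'a \<Rightarrow> 'a \<Rightarrow> nat" where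
  "graph_dist G u v = (LEAST k. \<exists>p. pre_digraph.apath (with_proj G) u p v \<and> length p = k)"

definition graph_diam :: "'a pair_pre_digraph \<Rightarrow> nat" where
  "graph_diam G = Max {graph_dist G u v | u v. u \<in> pverts G \<and> v \<in> pverts G}"

text \<open>Finiteness makes \<^const>\<open>pmf_of_set\<close> the uniform distribution on a nonempty
  \<^term>\<open>connected_graphs n d\<close>.\<close>

lemma finite_connected_graphs: "finite (connected_graphs n d)"
proof (rule finite_subset)
  show "connected_graphs n d \<subseteq>
    (\<lambda>E. \<lparr>pverts = {1..n}, parcs = E\<rparr>) ` Pow ({1..n} \<times> {1..n})"
  proof
    fix G assume G: "G \<in> connected_graphs n d"
    then interpret pair_graph G by (simp add: connected_graphs_def)
    have "pverts G = {1..n}" using G by (simp add: connected_graphs_def)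
    moreover from this have "parcs G \<subseteq> {1..n} \<times> {1..n}"
      using arc_fst_in_verts arc_snd_in_verts by auto
    ultimately show "G \<in> (\<lambda>E. \<lparr>pverts = {1..n}, parcs = E\<rparr>) ` Pow ({1..n} \<times> {1..n})"
      by (intro image_eqI[where x = "parcs G"]) auto
  qed
qed simp

end

theory Submission
  imports Defs
begin

text \<open>
  Fix a root \<open>u\<close>, let \<open>B\<^sub>j\<close> be the ball of radius \<open>j\<close> around \<open>u\<close>, let \<open>p\<^sub>j\<close> be the number of edges
  leaving \<open>B\<^sub>j\<close>, and let \<open>M\<close> be the sum of the degrees. The theorem reduces to the following: for a
  large constant multiple \<open>t\<close> of \<open>log n\<close>, it is very unlikely that at least half of the edges
  avoid \<open>B\<^sub>t\<close>. Indeed, if two vertices are further apart than \<open>2t + 1\<close>, then no edge touches both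
  of their balls of radius \<open>t\<close>, so one of the two balls is avoided by half of the edges
  (\<open>one_ball_is_small\<close>); a union bound over \<open>u\<close> and the trivial bound \<open>n\<close> on the diameter then
  finish the proof.

  Minimum degree 3 forces growth unless there are superfluous edges. Every vertex of a layer
  needs a single edge to the layer before it. If \<open>v\<close> is the number of edges to the layer \<open>L\<close>
  after \<open>B\<^sub>j\<close> that arrive at a vertex with several such edges, and \<open>h\<close> is the degree sum inside
  \<open>L\<close>, then counting the degrees in \<open>L\<close> gives \<open>2 p\<^sub>j \<le> 3 v + h + p\<^sub>j\<^sub>+\<^sub>1\<close> (\<open>layer_count\<close>). So either
  \<open>p\<^sub>j\<^sub>+\<^sub>1 \<ge> 3/2 p\<^sub>j\<close>, or the number of superfluous edges \<open>ab\<close>, vertical or horizontal, is at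
  least a constant times \<open>p\<^sub>j\<close>, and each of them can be removed without disconnecting the ball.

  In the second case the graph is switched: \<open>ab\<close> and an edge \<open>cd\<close> far away from the ball are replaced
  by \<open>ac\<close> and \<open>bd\<close>. Because \<open>cd\<close> is far away the result is simple; because \<open>a\<close> and \<open>b\<close> remain
  joined inside the ball it is connected; and \<open>B\<^sub>0, \<dots>, B\<^sub>j\<close> do not change. There are at least
  a constant times \<open>p\<^sub>j M\<close> such switchings. To undo one it suffices to find \<open>ac\<close> and \<open>bd\<close>
  among the edges leaving two known balls of the new graph, which leaves at most a constant times
  \<open>p\<^sub>j p\<^sub>j\<^sub>+\<^sub>1\<close> possibilities. Giving each graph the weight \<open>1 / p\<^sub>j\<^sub>+\<^sub>1\<close> cancels the unknown \<open>p\<^sub>j\<^sub>+\<^sub>1\<close>: the total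
  weight of the slowly growing graphs is at most a constant over \<open>M\<close> times the number of
  graphs that they are switched to (\<open>slow_growth_bound\<close>). Growing graphs lose a factor \<open>2/3\<close> in weight
  by definition.

  Consequently the total weight at radius \<open>j + 2\<close> is at most \<open>2/3\<close> of that at radius \<open>j + 1\<close> plus
  a small multiple of that at radius \<open>j\<close> (\<open>mass_recursion\<close>), as long as \<open>p\<^sub>j\<close> is a small
  fraction of \<open>M\<close>. Each radius with a larger \<open>p\<^sub>j\<close> is paid for by an extra factor in the weight;
  there is only a bounded number of them because the \<open>p\<^sub>j\<close> add up to at most \<open>M\<close>. Hence the weight decays exponentially, and as
  it is never below a constant over \<open>M\<close> per graph, where \<open>M \<le> n\<^sup>2\<close>, so does the number of graphs.
\<close>

section \<open>Arc sets, balls and boundaries\<close>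

text \<open>
  A graph is its symmetric set of arcs, so that switchings are plain set operations; each edge
  counts twice.
\<close>

definition realisations :: "'a set \<Rightarrow> ('a \<Rightarrow> nat) \<Rightarrow> ('a \<times> 'a) set set" where
  "realisations V d =
     {E. E \<subseteq> V \<times> V \<and> sym E \<and> irrefl E \<and> (\<forall>v\<in>V. card (E `` {v}) = d v) \<and>
         (\<forall>x\<in>V. \<forall>y\<in>V. (x, y) \<in> E\<^sup>*)}"

lemma realisationsD:
  assumes "E \<in> realisations V d"
  shows "E \<subseteq> V \<times> V" "sym E" "irrefl E" "\<And>v. v \<in> V \<Longrightarrow> card (E `` {v}) = d v"
    "\<And>x y. x \<in> V \<Longrightarrow> y \<in> V \<Longrightarrow> (x, y) \<in> E\<^sup>*"
  using assms by (auto simp: realisations_def)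

lemma finite_realisation:
  assumes "finite V" "E \<in> realisations V d"
  shows "finite E"
  using finite_subset[OF realisationsD(1)[OF assms(2)]] assms(1) by simp

lemma finite_realisations: "finite V \<Longrightarrow> finite (realisations V d)"
  by (rule finite_subset[of _ "Pow (V \<times> V)"]) (auto simp: realisations_def)

fun ball_of :: "('a \<times> 'a) set \<Rightarrow> 'a \<Rightarrow> nat \<Rightarrow> 'a set" where
  "ball_of E u 0 = {u}"
| "ball_of E u (Suc j) = ball_of E u j \<union> E `` ball_of E u j"

definition boundary :: "('a \<times> 'a) set \<Rightarrow> 'a set \<Rightarrow> ('a \<times> 'a) set" where
  "boundary E X = E \<inter> X \<times> (- X)"

definition avoiding :: "('a \<times> 'a) set \<Rightarrow> 'a set \<Rightarrow> ('a \<times> 'a) set" where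
  "avoiding E X = E \<inter> (- X) \<times> (- X)"

lemma ball_of_mono: "i \<le> j \<Longrightarrow> ball_of E u i \<subseteq> ball_of E u j"
  by (induction rule: dec_induct) auto

lemma root_in_ball_of: "u \<in> ball_of E u j"
  using ball_of_mono[of 0 j E u] by simp

lemma neighbour_in_ball_of: "x \<in> ball_of E u j \<Longrightarrow> (x, y) \<in> E \<Longrightarrow> y \<in> ball_of E u (Suc j)"
  by auto

lemma ball_of_subset: "E \<subseteq> V \<times> V \<Longrightarrow> u \<in> V \<Longrightarrow> ball_of E u j \<subseteq> V"
  by (induction j) auto

lemma ball_of_reachable: "x \<in> ball_of E u j \<Longrightarrow> (u, x) \<in> E\<^sup>*"
  by (induction j arbitrary: x) (auto intro: rtrancl_into_rtrancl)

lemma ball_of_trans: "x \<in> ball_of E u i \<Longrightarrow> y \<in> ball_of E x j \<Longrightarrow> y \<in> ball_of E u (i + j)"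
  by (induction j arbitrary: y) auto

lemma ball_of_sym:
  assumes "sym E" "x \<in> ball_of E u j" shows "u \<in> ball_of E x j"
  using assms(2)
proof (induction j arbitrary: x)
  case (Suc j)
  show ?case
  proof (cases "x \<in> ball_of E u j")
    case False
    then obtain z where z: "z \<in> ball_of E u j" "(z, x) \<in> E" using Suc.prems by auto
    have "z \<in> ball_of E x 1" using z(2) assms(1) by (auto dest: symD)
    from ball_of_trans[OF this Suc.IH[OF z(1)]] show ?thesis by simp
  qed (use Suc.IH in auto)
qed simp

text \<open>
  Balls see only the arcs that start in smaller balls, hence the radius \<open>j + 1\<close> in the conclusion.
\<close>

lemma ball_of_cong:
  assumes "\<And>x. x \<in> ball_of E u j \<Longrightarrow> E' `` {x} = E `` {x}" "t \<le> Suc j"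
  shows "ball_of E' u t = ball_of E u t"
  using assms(2)
proof (induction t)
  case (Suc t)
  have "E' `` ball_of E u t = E `` ball_of E u t"
    using assms(1) ball_of_mono[of t j E u] Suc.prems by (simp add: Image_def subset_iff) blast
  then show ?case using Suc by simp
qed simp

text \<open>
  The arcs that start in \<open>X\<close> are counted by the degrees, and the arcs that enter \<open>X\<close> from outside are the
  reversed boundary. So a graph operation that keeps the degrees and the size of the boundary
  of \<open>X\<close> also keeps the number of arcs that avoid \<open>X\<close>.
\<close>

lemma card_outside_arcs:
  assumes "finite E" "sym E" "finite X" "\<And>v. v \<in> X \<Longrightarrow> card (E `` {v}) = d v"
  shows "card (avoiding E X) + (\<Sum>v\<in>X. d v) + card (boundary E X) = card E"
proof -
  have "(\<Sum>v\<in>X. d v) = card (SIGMA v:X. E `` {v})"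
    using assms by (subst card_SigmaI) (auto intro: finite_subset[of _ "snd ` E"] simp: image_iff)
  also have "(SIGMA v:X. E `` {v}) = E \<inter> X \<times> UNIV" by auto
  finally have 1: "(\<Sum>v\<in>X. d v) = card (E \<inter> X \<times> UNIV)" .
  have "boundary E X = (E \<inter> (- X) \<times> X)\<inverse>" using assms(2) by (auto simp: boundary_def dest: symD)
  then have 2: "card (boundary E X) = card (E \<inter> (- X) \<times> X)" by simp
  have "E = avoiding E X \<union> (E \<inter> X \<times> UNIV \<union> E \<inter> (- X) \<times> X)" by (auto simp: avoiding_def)
  also have "card \<dots> = card (avoiding E X) + (card (E \<inter> X \<times> UNIV) + card (E \<inter> (- X) \<times> X))"
    using assms(1)
    by (subst card_Un_disjoint; (subst card_Un_disjoint)?) (auto simp: avoiding_def)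
  finally show ?thesis using 1 2 by simp
qed

lemma boundary_nonempty:
  assumes "(x, y) \<in> E\<^sup>*" "x \<in> X" "y \<notin> X"
  shows "boundary E X \<noteq> {}"
  using assms by (induction rule: rtrancl_induct) (auto simp: boundary_def)

declare ball_of.simps(2) [simp del]
lemmas ball_of_Suc = ball_of.simps(2)

section \<open>Switchings\<close>

text \<open>
  The edges \<open>ab\<close> and \<open>cd\<close> become \<open>ac\<close> and \<open>bd\<close>. With the arguments in this form, the inverse of
  switching \<open>(a, b)\<close> with \<open>(c, d)\<close> is switching \<open>(a, c)\<close> with \<open>(b, d)\<close>.
\<close>

definition switch :: "'a \<times> 'a \<Rightarrow> 'a \<times> 'a \<Rightarrow> ('a \<times> 'a) set \<Rightarrow> ('a \<times> 'a) set" where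
  "switch e f E = (case (e, f) of ((a, b), (c, d)) \<Rightarrow>
     E - {(a, b), (b, a), (c, d), (d, c)} \<union> {(a, c), (c, a), (b, d), (d, b)})"

lemma switch_simp:
  "switch (a, b) (c, d) E = E - {(a, b), (b, a), (c, d), (d, c)} \<union> {(a, c), (c, a), (b, d), (d, b)}"
  by (simp add: switch_def)

lemma switch_switch:
  assumes "sym E" "(a, b) \<in> E" "(c, d) \<in> E" "(a, c) \<notin> E" "(b, d) \<notin> E"
  shows "switch (a, c) (b, d) (switch (a, b) (c, d) E) = E"
proof -
  have "(b, a) \<in> E" "(d, c) \<in> E" "(c, a) \<notin> E" "(d, b) \<notin> E"
    using assms by (auto dest: symD)
  then show ?thesis using assms unfolding switch_simp by (intro equalityI subsetI) auto
qed

lemma switch_neighbours: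
  assumes "sym E" "irrefl E" "(a, b) \<in> E" "(c, d) \<in> E" "(a, c) \<notin> E" "(b, d) \<notin> E"
    "{a, b} \<inter> {c, d} = {}"
  shows "switch (a, b) (c, d) E `` {x} =
    (if x = a then E `` {x} - {b} \<union> {c} else if x = b then E `` {x} - {a} \<union> {d}
     else if x = c then E `` {x} - {d} \<union> {a} else if x = d then E `` {x} - {c} \<union> {b}
     else E `` {x})"
proof -
  have "a \<noteq> b" "c \<noteq> d" using assms by (auto simp: irrefl_def)
  then show ?thesis using assms(7) unfolding switch_simp by auto
qed

text \<open>
  Connectedness survives as soon as \<open>a\<close> and \<open>b\<close> stay connected: then \<open>c\<close> and \<open>d\<close> are connected
  through \<open>a\<close> and \<open>b\<close>, and both removed edges can be bypassed.
\<close>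

lemma switch_realisation:
  assumes fin: "finite V" and E: "E \<in> realisations V \<delta>"
    and sw: "(a, b) \<in> E" "(c, d) \<in> E" "(a, c) \<notin> E" "(b, d) \<notin> E" "{a, b} \<inter> {c, d} = {}"
    and conn: "(a, b) \<in> (switch (a, b) (c, d) E)\<^sup>*"
  shows "switch (a, b) (c, d) E \<in> realisations V \<delta>"
proof -
  let ?E = "switch (a, b) (c, d) E"
  note D = realisationsD[OF E]
  have fE: "finite (E `` {v})" for v
    using finite_realisation[OF fin E] by (auto intro: finite_subset[of _ "snd ` E"] simp: image_iff)
  have rev: "(b, a) \<in> E" "(d, c) \<in> E" "(c, a) \<notin> E" "(d, b) \<notin> E"
    using sw D(2) by (auto dest: symD)
  \<comment> \<open>Each of the four vertices exchanges one neighbour for a new one.\<close>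
  have swap: "card (S - {x} \<union> {y}) = card S" if "finite S" "x \<in> S" "y \<notin> S" for S and x y :: 'a
  proof -
    have "card (S - {x} \<union> {y}) = Suc (card (S - {x}))" using that by simp
    then show ?thesis using that by (metis card_Suc_Diff1)
  qed
  have "card (?E `` {v}) = card (E `` {v})" for v
    unfolding switch_neighbours[OF D(2,3) sw]
    using fE sw rev by (auto simp del: Un_insert_right intro!: swap)
  then have deg: "\<forall>v\<in>V. card (?E `` {v}) = \<delta> v" using D(4) by simp
  have "sym ?E" using D(2) unfolding switch_simp by (auto simp: sym_def)
  have sub: "?E \<subseteq> V \<times> V" using D(1) sw unfolding switch_simp by auto
  have irr: "irrefl ?E" using D(3) sw unfolding switch_simp irrefl_def by auto
  have symr: "sym (?E\<^sup>*)" using \<open>sym ?E\<close> by (rule sym_rtrancl)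
  have ca: "(c, a) \<in> ?E\<^sup>*" "(b, d) \<in> ?E\<^sup>*" unfolding switch_simp by auto
  then have cd: "(c, d) \<in> ?E\<^sup>*" using conn by (meson rtrancl_trans)
  have "E \<subseteq> ?E\<^sup>*"
  proof (rule subrelI)
    fix x y assume xy: "(x, y) \<in> E"
    then consider "(x, y) = (a, b)" | "(x, y) = (b, a)" | "(x, y) = (c, d)" | "(x, y) = (d, c)"
      | "(x, y) \<in> ?E" unfolding switch_simp by blast
    then show "(x, y) \<in> ?E\<^sup>*" using conn cd symr by cases (auto dest: symD)
  qed
  then have "E\<^sup>* \<subseteq> ?E\<^sup>*" by (metis rtrancl_idemp rtrancl_mono)
  then show ?thesis using deg sub irr \<open>sym ?E\<close> D(5) by (auto simp: realisations_def)
qed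

section \<open>Weighted double counting\<close>

text \<open>
  Each \<open>E\<close> in \<open>D\<close> splits its weight among its moves \<open>q \<in> F E\<close>, each of which carries the share \<open>g E\<close> to the
  target \<open>\<phi> q E\<close>. Since the target and the move determine \<open>E\<close>, a target receives at most one share for each
  move in \<open>Q E\<close>. The price \<open>\<kappa>\<close> bounds the share in terms of the target, so the counting works although the
  number of moves varies from one \<open>E\<close> to the next.
\<close>

lemma weighted_double_counting:
  fixes w :: "'e \<Rightarrow> real" and \<kappa> :: "'e \<Rightarrow> 'q \<Rightarrow> real"
  assumes fin: "finite D" "finite R" "\<And>E. E \<in> D \<Longrightarrow> finite (F E)" "\<And>E. E \<in> R \<Longrightarrow> finite (Q E)"
    and to: "\<And>E q. E \<in> D \<Longrightarrow> q \<in> F E \<Longrightarrow> \<phi> q E \<in> R \<and> q \<in> Q (\<phi> q E)"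
    and undo: "\<And>E q. E \<in> D \<Longrightarrow> q \<in> F E \<Longrightarrow> \<psi> q (\<phi> q E) = E"
    and forward: "\<And>E. E \<in> D \<Longrightarrow> w E \<le> real (card (F E)) * g E"
    and price: "\<And>E q. E \<in> D \<Longrightarrow> q \<in> F E \<Longrightarrow> g E \<le> \<kappa> (\<phi> q E) q"
    and pos: "\<And>E q. E \<in> R \<Longrightarrow> q \<in> Q E \<Longrightarrow> 0 \<le> \<kappa> E q"
    and income: "\<And>E. E \<in> R \<Longrightarrow> (\<Sum>q\<in>Q E. \<kappa> E q) \<le> \<beta> E"
  shows "(\<Sum>E\<in>D. w E) \<le> (\<Sum>E\<in>R. \<beta> E)"
proof -
  let ?h = "\<lambda>(E, q). (\<phi> q E, q)"
  have "(\<Sum>E\<in>D. w E) \<le> (\<Sum>E\<in>D. \<Sum>q\<in>F E. \<kappa> (\<phi> q E) q)"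
  proof (rule sum_mono)
    fix E assume E: "E \<in> D"
    have "w E \<le> (\<Sum>q\<in>F E. g E)" using forward[OF E] by simp
    also have "\<dots> \<le> (\<Sum>q\<in>F E. \<kappa> (\<phi> q E) q)" by (intro sum_mono price E)
    finally show "w E \<le> (\<Sum>q\<in>F E. \<kappa> (\<phi> q E) q)" .
  qed
  also have "\<dots> = (\<Sum>(E, q)\<in>Sigma D F. case ?h (E, q) of (E', q') \<Rightarrow> \<kappa> E' q')"
    using fin(1,3) by (simp add: sum.Sigma)
  also have "\<dots> = (\<Sum>(E, q)\<in>?h ` Sigma D F. \<kappa> E q)"
  proof -
    have "inj_on ?h (Sigma D F)"
    proof (rule inj_onI)
      fix p p' assume p: "p \<in> Sigma D F" "p' \<in> Sigma D F" and eq: "?h p = ?h p'"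
      obtain E q E' q' where pq: "p = (E, q)" "p' = (E', q')" by (cases p, cases p')
      have mem: "E \<in> D" "q \<in> F E" "E' \<in> D" "q' \<in> F E'" using p unfolding pq by auto
      have same: "q = q'" "\<phi> q E = \<phi> q' E'" using eq unfolding pq by auto
      have "E = \<psi> q (\<phi> q E)" by (rule undo[OF mem(1,2), symmetric])
      also have "\<dots> = \<psi> q' (\<phi> q' E')" unfolding same(2) unfolding same(1) by (rule refl)
      also have "\<dots> = E'" by (rule undo[OF mem(3,4)])
      finally show "p = p'" using same(1) unfolding pq by (rule arg_cong2[where f = Pair])
    qed
    then show ?thesis by (subst sum.reindex) (simp_all add: o_def case_prod_beta)
  qed
  also have "\<dots> \<le> (\<Sum>(E, q)\<in>Sigma R Q. \<kappa> E q)"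
  proof (rule sum_mono2)
    show "finite (Sigma R Q)" using fin(2,4) by (rule finite_SigmaI)
    show "?h ` Sigma D F \<subseteq> Sigma R Q" using to by auto
  qed (use pos in auto)
  also have "\<dots> = (\<Sum>E\<in>R. \<Sum>q\<in>Q E. \<kappa> E q)" using fin(2,4) by (simp add: sum.Sigma)
  also have "\<dots> \<le> (\<Sum>E\<in>R. \<beta> E)" by (intro sum_mono income)
  finally show ?thesis .
qed

text \<open>
  The price of a switching has this form: one over the number of choices for the first
  new edge, times one over the number of choices for the second, given the first.
\<close>

lemma sum_uniform_pairs_le:
  fixes K :: real
  assumes "0 \<le> K" "finite X" "\<And>x. x \<in> X \<Longrightarrow> finite (Y x)"
  shows "(\<Sum>p\<in>Sigma X Y. K / (real (card X) * real (card (Y (fst p))))) \<le> K"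
proof -
  have "(\<Sum>p\<in>Sigma X Y. K / (real (card X) * real (card (Y (fst p))))) =
      (\<Sum>x\<in>X. \<Sum>z\<in>Y x. K / (real (card X) * real (card (Y x))))"
    using assms by (subst sum.Sigma) (auto simp: case_prod_beta)
  also have "\<dots> \<le> (\<Sum>x\<in>X. K / real (card X))"
    using assms by (intro sum_mono) (auto simp: field_simps)
  also have "\<dots> \<le> K" using assms by (cases "card X = 0") auto
  finally show ?thesis .
qed

text \<open>
  A radius counts as wide if more than \<open>1 / wideness\<close> of all arcs leave its ball. Any value that is at
  least \<open>16 * 408\<close> works: \<open>408\<close> is the constant of the switching bound and \<open>1 / 16\<close> the coefficient
  that the recursion below tolerates.
\<close>

definition wideness :: nat where "wideness = 7000"

lemma wideness_large: "6528 \<le> wideness" "0 < wideness"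
  by (simp_all add: wideness_def)

section \<open>Layers around a root\<close>

locale rooted_realisations =
  fixes V :: "'a set" and \<delta> :: "'a \<Rightarrow> nat" and u :: 'a
  assumes finite_V: "finite V" and root: "u \<in> V" and min_degree: "\<And>v. v \<in> V \<Longrightarrow> 3 \<le> \<delta> v"
begin

abbreviation graphs :: "('a \<times> 'a) set set" where
  "graphs \<equiv> realisations V \<delta>"

abbreviation B :: "('a \<times> 'a) set \<Rightarrow> nat \<Rightarrow> 'a set" where
  "B E j \<equiv> ball_of E u j"

definition perimeter :: "('a \<times> 'a) set \<Rightarrow> nat \<Rightarrow> nat" where
  "perimeter E j = card (boundary E (B E j))"

definition arc_total :: nat where "arc_total = (\<Sum>v\<in>V. \<delta> v)"

text \<open>
  Smallness is measured by the arcs that avoid the ball because these supply the distant arcs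
  of the switchings.
\<close>

definition small_ball :: "nat \<Rightarrow> ('a \<times> 'a) set set" where
  "small_ball t = {E \<in> graphs. arc_total \<le> 2 * card (avoiding E (B E t))}"

lemma finE: "E \<in> graphs \<Longrightarrow> finite E"
  using finite_realisation[OF finite_V] .

lemma finite_boundary: "E \<in> graphs \<Longrightarrow> finite (boundary E X)"
  using finE by (simp add: boundary_def)

lemma B_subset: "E \<in> graphs \<Longrightarrow> B E t \<subseteq> V"
  using ball_of_subset[OF realisationsD(1) root] .

lemma finite_B: "E \<in> graphs \<Longrightarrow> finite (B E t)"
  using B_subset finite_V finite_subset by metis

lemma card_outside:
  assumes "E \<in> graphs" "X \<subseteq> V"
  shows "card (avoiding E X) + (\<Sum>v\<in>X. \<delta> v) + card (boundary E X) = card E"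
  using assms finite_V
  by (intro card_outside_arcs finE realisationsD(2)) (auto intro: finite_subset realisationsD(4))

lemma card_arcs: assumes E: "E \<in> graphs" shows "card E = arc_total"
proof -
  have "avoiding E V = {}" "boundary E V = {}"
    using realisationsD(1)[OF E] by (auto simp: avoiding_def boundary_def)
  then show ?thesis using card_outside[OF E order_refl] by (simp add: arc_total_def)
qed

lemma arc_total_pos: "0 < arc_total"
proof -
  have "\<delta> u \<le> arc_total" unfolding arc_total_def using finite_V root by (intro member_le_sum) auto
  then show ?thesis using min_degree[OF root] by simp
qed

lemma perimeter_le: "E \<in> graphs \<Longrightarrow> perimeter E t \<le> arc_total"
  using card_mono[OF finE, of E "boundary E (B E t)"] card_arcs by (auto simp: perimeter_def boundary_def)

lemma small_ballD: "E \<in> small_ball t \<Longrightarrow> E \<in> graphs"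
  "E \<in> small_ball t \<Longrightarrow> arc_total \<le> 2 * card (avoiding E (B E t))"
  by (auto simp: small_ball_def)

lemma finite_small_ball: "finite (small_ball t)"
  using finite_realisations[OF finite_V] by (simp add: small_ball_def)

lemma small_ball_antimono: assumes "s \<le> t" shows "small_ball t \<subseteq> small_ball s"
proof
  fix E assume E: "E \<in> small_ball t"
  have "avoiding E (B E t) \<subseteq> avoiding E (B E s)"
    using ball_of_mono[OF assms, of E u] by (auto simp: avoiding_def)
  then have "card (avoiding E (B E t)) \<le> card (avoiding E (B E s))"
    using finE[OF small_ballD(1)[OF E]] by (intro card_mono) (auto simp: avoiding_def)
  then show "E \<in> small_ball s" using E by (simp add: small_ball_def)
qed

text \<open>
  Arcs outside the ball exist, and the graph is connected.
\<close>

lemma perimeter_pos: assumes "E \<in> small_ball t" shows "0 < perimeter E t"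
proof -
  note E = small_ballD(1)[OF assms]
  have "card (avoiding E (B E t)) \<noteq> 0" using small_ballD(2)[OF assms] arc_total_pos by linarith
  then obtain c d where "(c, d) \<in> avoiding E (B E t)" by (metis card.empty equals0I surj_pair)
  then have "c \<in> V" "c \<notin> B E t" using realisationsD(1)[OF E] by (auto simp: avoiding_def)
  then have "boundary E (B E t) \<noteq> {}"
    using realisationsD(5)[OF E root] root_in_ball_of[of u E t] by (intro boundary_nonempty) auto
  then show ?thesis using finite_boundary[OF E] by (simp add: perimeter_def card_gt_0_iff)
qed

text \<open>
  These arcs are superfluous: without one of them, every vertex of the ball of radius \<open>j + 1\<close> other than
  the root still has a neighbour closer to the root.
\<close>

definition vertical :: "nat \<Rightarrow> ('a \<times> 'a) set \<Rightarrow> ('a \<times> 'a) set" where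
  "vertical j E = {(a, b) \<in> boundary E (B E j). \<exists>p\<in>B E j. p \<noteq> a \<and> (p, b) \<in> E}"

definition horizontal :: "nat \<Rightarrow> ('a \<times> 'a) set \<Rightarrow> ('a \<times> 'a) set" where
  "horizontal j E = E \<inter> (B E (Suc j) - B E j) \<times> (B E (Suc j) - B E j)"

text \<open>
  Every vertex of the next layer \<open>L\<close> has at most one arc from the ball that is not vertical, so
  \<open>perimeter E j \<le> v + card L\<close> for the number \<open>v\<close> of vertical arcs. As all degrees are at least \<open>3\<close>,
  \<open>3 * card L\<close> is at most the degree sum of \<open>L\<close>, which consists of the arcs
  back to the ball, the horizontal ones and the ones to the layer after.
\<close>

lemma layer_count:
  assumes E: "E \<in> graphs"
  shows "2 * perimeter E j \<le> 3 * card (vertical j E) + card (horizontal j E) + perimeter E (Suc j)"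
proof -
  let ?L = "B E (Suc j) - B E j"
  have fL: "finite ?L" by (rule finite_Diff[OF finite_B[OF E]])
  note [simp] = finE[OF E] finite_boundary[OF E]
  \<comment> \<open>A vertex with two arcs from the ball has only vertical ones, so the end point determines the others.\<close>
  have "card (boundary E (B E j) - vertical j E) \<le> card ?L"
  proof (rule card_inj_on_le[where f = snd])
    show "inj_on snd (boundary E (B E j) - vertical j E)"
      by (rule inj_onI) (auto simp: vertical_def boundary_def)
    show "snd ` (boundary E (B E j) - vertical j E) \<subseteq> ?L"
      by (auto simp: boundary_def ball_of_Suc)
  qed (rule fL)
  moreover have "card (boundary E (B E j)) =
      card (vertical j E) + card (boundary E (B E j) - vertical j E)"
    by (subst card_Un_disjoint[symmetric])
       (auto simp: vertical_def intro!: arg_cong[where f = card] finite_subset[OF _ finite_boundary[OF E]])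
  ultimately have 1: "perimeter E j \<le> card (vertical j E) + card ?L" by (simp add: perimeter_def)
  have "3 * card ?L \<le> (\<Sum>v\<in>?L. \<delta> v)"
  proof -
    have "(\<Sum>v\<in>?L. 3) \<le> (\<Sum>v\<in>?L. \<delta> v)"
      using B_subset[OF E, of "Suc j"] by (intro sum_mono min_degree) auto
    then show ?thesis by simp
  qed
  also have "\<dots> = (\<Sum>v\<in>?L. card (E `` {v}))"
    using B_subset[OF E, of "Suc j"] by (intro sum.cong refl realisationsD(4)[OF E, symmetric]) auto
  also have "\<dots> = card (SIGMA v:?L. E `` {v})"
    using fL by (subst card_SigmaI) (auto intro: finite_subset[of _ "snd ` E"] simp: image_iff)
  also have "\<dots> \<le> card ((boundary E (B E j))\<inverse> \<union> horizontal j E \<union> boundary E (B E (Suc j)))"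
  proof (rule card_mono)
    show "(SIGMA v:?L. E `` {v}) \<subseteq>
      (boundary E (B E j))\<inverse> \<union> horizontal j E \<union> boundary E (B E (Suc j))"
      using realisationsD(2)[OF E] by (auto simp: boundary_def horizontal_def ball_of_Suc dest: symD)
  qed (simp add: horizontal_def)
  also have "\<dots> \<le> perimeter E j + card (horizontal j E) + perimeter E (Suc j)"
    unfolding perimeter_def by (intro order_trans[OF card_Un_le] add_mono) (simp_all add: card_Un_le[THEN order_trans])
  finally show ?thesis using 1 by linarith
qed

lemma switch_away_from_ball:
  assumes E: "E \<in> graphs" and sw: "(a, b) \<in> E" "(c, d) \<in> E" "(a, c) \<notin> E" "(b, d) \<notin> E"
    and far: "{a, b, c, d} \<inter> B E j = {}" "{a, b} \<inter> {c, d} = {}"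
    and E': "E' = switch (a, b) (c, d) E"
  shows "t \<le> Suc j \<Longrightarrow> B E' t = B E t"
    and "t \<le> j \<Longrightarrow> perimeter E' t = perimeter E t"
proof -
  note D = realisationsD[OF E]
  have nb: "E' `` {x} = E `` {x}" if "x \<in> B E j" for x
    using that far(1) unfolding E' switch_neighbours[OF D(2,3) sw far(2)] by auto
  show b: "B E' t = B E t" if "t \<le> Suc j" for t
    using ball_of_cong[of E u j E' t] nb that by simp
  show "perimeter E' t = perimeter E t" if "t \<le> j"
  proof -
    have "(x, z) \<in> E' \<longleftrightarrow> (x, z) \<in> E" if "x \<in> B E t" for x z
      using nb[of x] ball_of_mono[OF \<open>t \<le> j\<close>, of E u] that by blast
    then have "boundary E' (B E t) = boundary E (B E t)" by (auto simp: boundary_def)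
    then show ?thesis using b[of t] that by (simp add: perimeter_def)
  qed
qed

lemma small_ball_transfer:
  assumes "E \<in> small_ball t" "E' \<in> graphs" "B E' t = B E t" "perimeter E' t = perimeter E t"
  shows "E' \<in> small_ball t"
  using card_outside[OF assms(2) B_subset[OF assms(2), of t]]
    card_outside[OF small_ballD(1)[OF assms(1)] B_subset[OF small_ballD(1)[OF assms(1)], of t]]
    small_ballD[OF assms(1)] card_arcs[OF assms(2)] card_arcs[of E] assms(2,3,4)
  by (simp add: small_ball_def perimeter_def)

section \<open>Switching a superfluous arc with a distant arc\<close>

text \<open>
  The far end \<open>c\<close> of the new arc \<open>(a, c)\<close> enters the layer in which \<open>b\<close> lies, and \<open>b\<close> stays there because of its other
  neighbour. Thus, once \<open>(a, c)\<close> has been found in the boundary of the ball of radius \<open>j + 1\<close>, the old ball of radius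
  \<open>j + 2\<close> is the new one without \<open>c\<close>, and \<open>(b, d)\<close> lies in its boundary.
\<close>

lemma vertical_switch:
  assumes E: "E \<in> small_ball (j + 3)" and ab: "(a, b) \<in> vertical (j + 1) E"
    and cd: "(c, d) \<in> avoiding E (B E (j + 3))"
    and E': "E' = switch (a, b) (c, d) E"
  shows "E' \<in> small_ball (j + 1)"
    and "t \<le> j + 1 \<Longrightarrow> perimeter E' t = perimeter E t"
    and "switch (a, c) (b, d) E' = E"
    and "(a, c) \<in> boundary E' (B E' (j + 1))"
    and "(b, d) \<in> boundary E' (B E' (j + 2) - {c})"
    and "card (boundary E' (B E' (j + 2) - {c})) = perimeter E (j + 2) + 2"
proof -
  let ?B1 = "B E (j + 1)" and ?B2 = "B E (j + 2)" and ?B3 = "B E (j + 3)"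
  note G = small_ballD(1)[OF E]
  note D = realisationsD[OF G]
  obtain p where p: "p \<in> ?B1" "p \<noteq> a" "(p, b) \<in> E" using ab by (auto simp: vertical_def)
  have ab': "(a, b) \<in> E" "a \<in> ?B1" "b \<notin> ?B1" using ab by (auto simp: vertical_def boundary_def)
  have cd': "(c, d) \<in> E" "c \<notin> ?B3" "d \<notin> ?B3" using cd by (auto simp: avoiding_def)
  have B2: "?B2 = ?B1 \<union> E `` ?B1"
    by (simp add: numeral_eq_Suc ball_of_Suc)
  have b2: "b \<in> ?B2" using ab' B2 by auto
  have step: "z \<in> ?B3" if "x \<in> ?B2" "(x, z) \<in> E" for x z
    using neighbour_in_ball_of[OF that] by (simp add: numeral_eq_Suc)
  have non: "(a, c) \<notin> E" "(b, d) \<notin> E" using step[of a c] step[of b d] ab' b2 cd' B2 by auto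
  have a0: "a \<notin> B E j" using ab' neighbour_in_ball_of[of a E u j b] by auto
  have sub: "B E j \<subseteq> ?B1" "?B1 \<subseteq> ?B2" "?B2 \<subseteq> ?B3" by (simp_all add: ball_of_mono)
  have far: "{a, b, c, d} \<inter> B E j = {}" "{a, b} \<inter> {c, d} = {}"
    using a0 ab' cd' b2 sub by auto
  note same = switch_away_from_ball[OF G ab'(1) cd'(1) non far E']
  have s1: "B E' (j + 1) = ?B1" using same(1) by simp
  have arcs: "(x, z) \<in> E' \<longleftrightarrow> (x, z) \<in> E \<and> (x, z) \<notin> {(a, b), (b, a), (c, d), (d, c)} \<or>
      (x, z) \<in> {(a, c), (c, a), (b, d), (d, b)}" for x z
    unfolding E' switch_simp by blast
  have s2: "B E' (j + 2) = insert c ?B2"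
  proof -
    have "E' `` ?B1 = insert c (E `` ?B1)"
    proof (rule set_eqI)
      fix z
      \<comment> \<open>The other neighbour \<open>p\<close> keeps \<open>b\<close> in its layer.\<close>
      have "(p, b) \<in> E'" using p ab' cd' sub arcs by auto
      moreover have "(x, z) \<in> E' \<longleftrightarrow> (x, z) \<in> E" if "x \<in> ?B1" "z \<noteq> b" "z \<noteq> c" for x
        using that ab' cd' sub unfolding arcs by blast
      moreover have "(a, c) \<in> E'" using arcs by blast
      ultimately show "z \<in> E' `` ?B1 \<longleftrightarrow> z \<in> insert c (E `` ?B1)"
        using p(1,3) ab'(2) by (cases "z = b"; cases "z = c") blast+
    qed
    then show ?thesis using s1 B2 by (simp add: numeral_eq_Suc ball_of_Suc)
  qed
  have "(u, a) \<in> E'\<^sup>*" "(u, b) \<in> E'\<^sup>*"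
    using ball_of_reachable[of _ E' u] s1 s2 ab'(2) b2 by blast+
  moreover have "sym (E'\<^sup>*)" using D(2) arcs by (intro sym_rtrancl) (auto simp: sym_def)
  ultimately have "(a, b) \<in> E'\<^sup>*" by (meson rtrancl_trans symD)
  then have G': "E' \<in> graphs"
    using switch_realisation[OF finite_V G ab'(1) cd'(1) non far(2)] E' by simp
  \<comment> \<open>The arc \<open>(a, c)\<close> takes the place of \<open>(a, b)\<close>.\<close>
  have bd1: "boundary E' ?B1 = insert (a, c) (boundary E ?B1 - {(a, b)})"
    using ab' cd' sub by (auto simp: boundary_def arcs)
  have "(a, b) \<in> boundary E ?B1" "(a, c) \<notin> boundary E ?B1 - {(a, b)}"
    using ab' non by (auto simp: boundary_def)
  then have "card (boundary E' ?B1) = card (boundary E ?B1)"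
    unfolding bd1 using finite_boundary[OF G, of ?B1] by (metis card_Suc_Diff1 card_insert_disjoint finite_Diff)
  then show yt: "perimeter E' t = perimeter E t" if "t \<le> j + 1" for t
    using that same(2)[of t] s1 by (cases "t = j + 1") (auto simp: perimeter_def)
  show "E' \<in> small_ball (j + 1)"
    using small_ball_antimono[of "j + 1" "j + 3"] E
    by (intro small_ball_transfer[OF _ G' s1 yt]) auto
  show "switch (a, c) (b, d) E' = E"
    unfolding E' by (rule switch_switch[OF D(2) ab'(1) cd'(1) non])
  show "(a, c) \<in> boundary E' (B E' (j + 1))" using bd1 s1 by simp
  have s2': "B E' (j + 2) - {c} = ?B2" using s2 cd' sub by auto
  have bd2: "boundary E' ?B2 = insert (a, c) (insert (b, d) (boundary E ?B2))"
    using ab' b2 cd' sub by (auto simp: boundary_def arcs)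
  show "(b, d) \<in> boundary E' (B E' (j + 2) - {c})" using bd2 s2' by simp
  have "a \<noteq> b" using ab' by auto
  then show "card (boundary E' (B E' (j + 2) - {c})) = perimeter E (j + 2) + 2"
    unfolding s2' bd2 using finite_boundary[OF G] non
    by (simp add: perimeter_def) (auto simp: boundary_def)
qed

text \<open>
  Here the ball of radius \<open>j + 2\<close> does not change, and both new arcs lie in its boundary.
\<close>

lemma horizontal_switch:
  assumes E: "E \<in> small_ball (j + 3)" and ab: "(a, b) \<in> horizontal (j + 1) E"
    and cd: "(c, d) \<in> avoiding E (B E (j + 3))"
    and E': "E' = switch (a, b) (c, d) E"
  shows "E' \<in> small_ball (j + 1)"
    and "t \<le> j + 1 \<Longrightarrow> perimeter E' t = perimeter E t"
    and "switch (a, c) (b, d) E' = E"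
    and "(a, c) \<in> boundary E' (B E' (j + 2))"
    and "(b, d) \<in> boundary E' (B E' (j + 2))"
    and "card (boundary E' (B E' (j + 2))) = perimeter E (j + 2) + 2"
proof -
  let ?B1 = "B E (j + 1)" and ?B2 = "B E (j + 2)" and ?B3 = "B E (j + 3)"
  note G = small_ballD(1)[OF E]
  note D = realisationsD[OF G]
  have ab': "(a, b) \<in> E" "a \<in> ?B2" "b \<in> ?B2" "a \<notin> ?B1" "b \<notin> ?B1"
    using ab by (auto simp: horizontal_def)
  have cd': "(c, d) \<in> E" "c \<notin> ?B3" "d \<notin> ?B3" using cd by (auto simp: avoiding_def)
  have step: "z \<in> ?B3" if "x \<in> ?B2" "(x, z) \<in> E" for x z
    using neighbour_in_ball_of[OF that] by (simp add: numeral_eq_Suc)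
  have non: "(a, c) \<notin> E" "(b, d) \<notin> E" using step[of a c] step[of b d] ab' cd' by auto
  have sub: "?B1 \<subseteq> ?B2" "?B2 \<subseteq> ?B3" by (simp_all add: ball_of_mono)
  have far: "{a, b, c, d} \<inter> ?B1 = {}" "{a, b} \<inter> {c, d} = {}"
    using ab' cd' sub by auto
  note same = switch_away_from_ball[OF G ab'(1) cd'(1) non far E']
  have s1: "B E' (j + 1) = ?B1" and s2: "B E' (j + 2) = ?B2" using same(1) by simp_all
  have arcs: "(x, z) \<in> E' \<longleftrightarrow> (x, z) \<in> E \<and> (x, z) \<notin> {(a, b), (b, a), (c, d), (d, c)} \<or>
      (x, z) \<in> {(a, c), (c, a), (b, d), (d, b)}" for x z
    unfolding E' switch_simp by blast
  have "(u, a) \<in> E'\<^sup>*" "(u, b) \<in> E'\<^sup>*"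
    using ball_of_reachable[of _ E' u] s2 ab' by blast+
  moreover have "sym (E'\<^sup>*)" using D(2) arcs by (intro sym_rtrancl) (auto simp: sym_def)
  ultimately have "(a, b) \<in> E'\<^sup>*" by (meson rtrancl_trans symD)
  then have G': "E' \<in> graphs"
    using switch_realisation[OF finite_V G ab'(1) cd'(1) non far(2)] E' by simp
  show yt: "perimeter E' t = perimeter E t" if "t \<le> j + 1" for t
    using that same(2)[of t] by simp
  show "E' \<in> small_ball (j + 1)"
    using small_ball_antimono[of "j + 1" "j + 3"] E
    by (intro small_ball_transfer[OF _ G' s1 yt]) auto
  show "switch (a, c) (b, d) E' = E"
    unfolding E' by (rule switch_switch[OF D(2) ab'(1) cd'(1) non])
  have bd2: "boundary E' ?B2 = insert (a, c) (insert (b, d) (boundary E ?B2))"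
    using ab' cd' sub by (auto simp: boundary_def arcs)
  show "(a, c) \<in> boundary E' (B E' (j + 2))" "(b, d) \<in> boundary E' (B E' (j + 2))"
    using bd2 s2 by simp_all
  have "a \<noteq> b" using ab' D(3) by (auto simp: irrefl_def)
  then show "card (boundary E' (B E' (j + 2))) = perimeter E (j + 2) + 2"
    unfolding s2 bd2 using finite_boundary[OF G] non
    by (simp add: perimeter_def) (auto simp: boundary_def)
qed

text \<open>
  The counting argument common to both kinds of superfluous arcs \<open>L E\<close>. There are at least
  \<open>perimeter E (j + 1) / 12 * arc_total / 2\<close> switchings, whence the factor \<open>24\<close>; \<open>X\<close> and \<open>Y\<close> are the sets
  in which the two new arcs are to be found.
\<close>

lemma switching_bound:
  fixes r :: real and X :: "('a \<times> 'a) set \<Rightarrow> ('a \<times> 'a) set" and Y :: "('a \<times> 'a) set \<Rightarrow> 'a \<times> 'a \<Rightarrow> ('a \<times> 'a) set"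
  assumes \<omega>: "\<And>E. 0 \<le> \<omega> E" and r: "0 \<le> r" and D: "D \<subseteq> small_ball (j + 3)"
    and L: "\<And>E. L E \<subseteq> E" "\<And>E. E \<in> D \<Longrightarrow> perimeter E (j + 1) \<le> 12 * card (L E)"
    and fin: "\<And>E. E \<in> graphs \<Longrightarrow> finite (X E)" "\<And>E e. E \<in> graphs \<Longrightarrow> finite (Y E e)"
    and sw: "\<And>E E' a b c d. E \<in> D \<Longrightarrow> (a, b) \<in> L E \<Longrightarrow> (c, d) \<in> avoiding E (B E (j + 3)) \<Longrightarrow>
      E' = switch (a, b) (c, d) E \<Longrightarrow>
      E' \<in> small_ball (j + 1) \<and> switch (a, c) (b, d) E' = E \<and> \<omega> E' = \<omega> E \<and>
      (a, c) \<in> X E' \<and> (b, d) \<in> Y E' (a, c) \<and>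
      real (card (X E') * card (Y E' (a, c))) \<le> r * real (perimeter E (j + 1)) * real (perimeter E (j + 2))"
  shows "(\<Sum>E\<in>D. \<omega> E / perimeter E (j + 2)) \<le> (\<Sum>E\<in>small_ball (j + 1). 24 * r / arc_total * \<omega> E)"
proof -
  let ?F = "\<lambda>E. L E \<times> avoiding E (B E (j + 3))"
  let ?tw = "\<lambda>((a, b), (c, d)). ((a, c), (b, d))"
  let ?\<phi> = "\<lambda>((a, b), (c, d)). switch (a, b) (c, d)"
  let ?\<kappa> = "\<lambda>E p. 24 * r / arc_total * \<omega> E / (real (card (X E)) * real (card (Y E (fst p))))"
  have pos: "0 < perimeter E (j + 1)" "0 < perimeter E (j + 2)" if "E \<in> D" for E
    using small_ball_antimono[of "j + 1" "j + 3"] small_ball_antimono[of "j + 2" "j + 3"] D that perimeter_pos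
    by auto
  show ?thesis
  proof (rule weighted_double_counting[where F = ?F and Q = "\<lambda>E. ?tw ` Sigma (X E) (Y E)"
      and \<phi> = ?\<phi> and \<psi> = "\<lambda>q. ?\<phi> (?tw q)"
      and g = "\<lambda>E. 24 * \<omega> E / (real arc_total * real (perimeter E (j + 1)) * real (perimeter E (j + 2)))"
      and \<kappa> = "\<lambda>E q. ?\<kappa> E (?tw q)"])
    show "finite D" "finite (small_ball (j + 1))"
      using finite_small_ball finite_subset[OF D] by auto
  next
    fix E assume "E \<in> D"
    then have "finite E" using finE small_ballD D by blast
    then show "finite (?F E)"
      using L(1) by (intro finite_cartesian_product) (auto simp: avoiding_def intro: finite_subset)
  next
    fix E assume "E \<in> small_ball (j + 1)"
    then have "E \<in> graphs" by (rule small_ballD)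
    then show "finite (?tw ` Sigma (X E) (Y E))"
      using fin by (intro finite_imageI finite_SigmaI) auto
  next
    fix E q assume E: "E \<in> D" and q: "q \<in> ?F E"
    obtain a b c d where q_eq: "q = ((a, b), (c, d))" by (metis surj_pair)
    define E' where "E' = switch (a, b) (c, d) E"
    have ab: "(a, b) \<in> L E" and cd: "(c, d) \<in> avoiding E (B E (j + 3))" using q q_eq by auto
    note S = sw[OF E ab cd E'_def]
    have \<phi>: "?\<phi> q E = E'" by (simp add: q_eq E'_def)
    have "?tw q \<in> Sigma (X E') (Y E')" using S by (simp add: q_eq)
    then have "?tw (?tw q) \<in> ?tw ` Sigma (X E') (Y E')" by (rule imageI)
    then show "?\<phi> q E \<in> small_ball (j + 1) \<and> q \<in> ?tw ` Sigma (X (?\<phi> q E)) (Y (?\<phi> q E))"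
      using S unfolding \<phi> by (simp add: q_eq)
    show "?\<phi> (?tw q) (?\<phi> q E) = E"
      unfolding \<phi> using S by (simp add: q_eq)
    have "E' \<in> graphs" using S small_ballD by blast
    then have N: "0 < real (card (X E') * card (Y E' (a, c)))"
    proof -
      have "X E' \<noteq> {}" "Y E' (a, c) \<noteq> {}" using S by blast+
      then have "0 < card (X E')" "0 < card (Y E' (a, c))"
        using fin \<open>E' \<in> graphs\<close> by (simp_all add: card_gt_0_iff)
      then show ?thesis by simp
    qed
    have N_le: "real (card (X E') * card (Y E' (a, c))) \<le> r * real (perimeter E (j + 1)) * real (perimeter E (j + 2))"
      using S by blast
    have N': "0 < r * real (perimeter E (j + 1)) * real (perimeter E (j + 2))" using N N_le by (rule less_le_trans)
    then have "24 * \<omega> E / (real (perimeter E (j + 1)) * real (perimeter E (j + 2)))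
        = 24 * \<omega> E * r / (r * real (perimeter E (j + 1)) * real (perimeter E (j + 2)))"
      by (cases "r = 0") simp_all
    also have "\<dots> \<le> 24 * \<omega> E * r / real (card (X E') * card (Y E' (a, c)))"
      using \<omega>[of E] r by (intro divide_left_mono N_le mult_pos_pos[OF N' N]) simp
    finally have "24 * \<omega> E / (real (perimeter E (j + 1)) * real (perimeter E (j + 2)))
        \<le> 24 * \<omega> E * r / real (card (X E') * card (Y E' (a, c)))" .
    then have "24 * \<omega> E / (real (perimeter E (j + 1)) * real (perimeter E (j + 2))) / real arc_total
        \<le> 24 * \<omega> E * r / real (card (X E') * card (Y E' (a, c))) / real arc_total"
      by (rule divide_right_mono) simp
    then show "24 * \<omega> E / (real arc_total * real (perimeter E (j + 1)) * real (perimeter E (j + 2))) \<le> ?\<kappa> (?\<phi> q E) (?tw q)"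
      unfolding \<phi> using S by (simp add: q_eq mult_ac)
  next
    fix E assume E: "E \<in> D"
    have "real (perimeter E (j + 1)) \<le> 12 * real (card (L E))"
      using L(2)[OF E] by simp
    moreover have "real arc_total \<le> 2 * real (card (avoiding E (B E (j + 3))))"
      using small_ballD(2)[of E "j + 3"] E D by auto
    ultimately have "real (perimeter E (j + 1)) * real arc_total \<le> 24 * real (card (?F E))"
      using mult_mono[of "real (perimeter E (j + 1))" "12 * real (card (L E))"
          "real arc_total" "2 * real (card (avoiding E (B E (j + 3))))"]
      by (simp add: card_cartesian_product)
    then have "real (perimeter E (j + 1)) * real arc_total * \<omega> E \<le> 24 * real (card (?F E)) * \<omega> E"
      using \<omega> by (rule mult_right_mono)
    then show "\<omega> E / perimeter E (j + 2) \<le>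
      real (card (?F E)) * (24 * \<omega> E / (real arc_total * real (perimeter E (j + 1)) * real (perimeter E (j + 2))))"
      using pos[OF E] arc_total_pos by (simp add: field_simps)
  next
    fix E q
    show "0 \<le> ?\<kappa> E (?tw q)" using \<omega> r by simp
  next
    fix E assume "E \<in> small_ball (j + 1)"
    then have E: "E \<in> graphs" by (rule small_ballD)
    have "inj_on ?tw (Sigma (X E) (Y E))" by (auto simp: inj_on_def)
    then have "(\<Sum>q\<in>?tw ` Sigma (X E) (Y E). ?\<kappa> E (?tw q)) = (\<Sum>p\<in>Sigma (X E) (Y E). ?\<kappa> E p)"
      by (subst sum.reindex) (auto intro!: sum.cong)
    also have "\<dots> \<le> 24 * r / arc_total * \<omega> E"
      using \<omega> r fin[OF E] by (intro sum_uniform_pairs_le) auto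
    finally show "(\<Sum>q\<in>?tw ` Sigma (X E) (Y E). ?\<kappa> E (?tw q)) \<le> 24 * r / arc_total * \<omega> E" .
  qed
qed

text \<open>
  If the perimeter grows by a factor below \<open>3/2\<close>, then \<open>layer_count\<close> leaves enough vertical or
  enough horizontal arcs. The weight \<open>\<omega>\<close> may depend on the history of the perimeters,
  which the switching does not change. For a horizontal arc both new arcs are sought in a boundary of
  size \<open>perimeter E (j + 2) + 2\<close>, and slow growth is used again to trade one of these factors
  for \<open>perimeter E (j + 1)\<close>. The constant is \<open>408 = 24 * 3 + 24 * 14\<close>.
\<close>

lemma slow_growth_bound:
  assumes \<omega>: "\<And>E. 0 \<le> \<omega> E"
    "\<And>E E'. (\<And>t. t \<le> j \<Longrightarrow> perimeter E' t = perimeter E t) \<Longrightarrow> \<omega> E' = \<omega> E"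
  shows "(\<Sum>E | E \<in> small_ball (j + 3) \<and> 2 * perimeter E (j + 2) < 3 * perimeter E (j + 1). \<omega> E / perimeter E (j + 2))
    \<le> 408 / arc_total * (\<Sum>E\<in>small_ball (j + 1). \<omega> E)"
proof -
  let ?slow = "{E \<in> small_ball (j + 3). 2 * perimeter E (j + 2) < 3 * perimeter E (j + 1)}"
  let ?V = "{E \<in> ?slow. perimeter E (j + 1) \<le> 12 * card (vertical (j + 1) E)}"
  let ?H = "{E \<in> ?slow. perimeter E (j + 1) \<le> 12 * card (horizontal (j + 1) E)}"
  have fin: "finite ?slow" using finite_small_ball by auto
  have pos: "0 < perimeter E (j + 2)" if "E \<in> small_ball (j + 3)" for E
    using small_ball_antimono[of "j + 2" "j + 3"] that perimeter_pos by auto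
  have V: "(\<Sum>E\<in>?V. \<omega> E / perimeter E (j + 2)) \<le> (\<Sum>E\<in>small_ball (j + 1). 24 * 3 / arc_total * \<omega> E)"
  proof (rule switching_bound[where L = "vertical (j + 1)" and X = "\<lambda>E. boundary E (B E (j + 1))"
      and Y = "\<lambda>E e. boundary E (B E (j + 2) - {snd e})"])
    fix E E' a b c d
    assume "E \<in> ?V" and ab: "(a, b) \<in> vertical (j + 1) E"
      and cd: "(c, d) \<in> avoiding E (B E (j + 3))" and E': "E' = switch (a, b) (c, d) E"
    then have E: "E \<in> small_ball (j + 3)" by simp
    note S = vertical_switch[OF E ab cd E']
    have "real (card (boundary E' (B E' (j + 1))) * card (boundary E' (B E' (j + 2) - {c})))
        \<le> 3 * real (perimeter E (j + 1)) * real (perimeter E (j + 2))"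
    proof -
      have "card (boundary E' (B E' (j + 1))) = perimeter E (j + 1)" using S(2)[of "j + 1"] by (simp add: perimeter_def)
      moreover have "perimeter E (j + 1) * (perimeter E (j + 2) + 2) \<le> perimeter E (j + 1) * (3 * perimeter E (j + 2))"
        using pos[OF E] by (intro mult_le_mono2) simp
      ultimately have "card (boundary E' (B E' (j + 1))) * card (boundary E' (B E' (j + 2) - {c}))
        \<le> 3 * perimeter E (j + 1) * perimeter E (j + 2)" using S(6) by simp
      then show ?thesis by (metis of_nat_le_iff of_nat_mult of_nat_numeral)
    qed
    moreover have "\<omega> E' = \<omega> E" using S(2) by (intro \<omega>(2)) auto
    ultimately show "E' \<in> small_ball (j + 1) \<and> switch (a, c) (b, d) E' = E \<and> \<omega> E' = \<omega> E \<and>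
      (a, c) \<in> boundary E' (B E' (j + 1)) \<and> (b, d) \<in> boundary E' (B E' (j + 2) - {snd (a, c)}) \<and>
      real (card (boundary E' (B E' (j + 1))) * card (boundary E' (B E' (j + 2) - {snd (a, c)})))
        \<le> 3 * real (perimeter E (j + 1)) * real (perimeter E (j + 2))"
      using S(1,3,4,5) by simp
  qed (auto simp: \<omega>(1) vertical_def boundary_def intro: finE)
  have H: "(\<Sum>E\<in>?H. \<omega> E / perimeter E (j + 2)) \<le> (\<Sum>E\<in>small_ball (j + 1). 24 * 14 / arc_total * \<omega> E)"
  proof (rule switching_bound[where L = "horizontal (j + 1)" and X = "\<lambda>E. boundary E (B E (j + 2))"
      and Y = "\<lambda>E e. boundary E (B E (j + 2))"])
    fix E E' a b c d
    assume EH: "E \<in> ?H" and ab: "(a, b) \<in> horizontal (j + 1) E"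
      and cd: "(c, d) \<in> avoiding E (B E (j + 3))" and E': "E' = switch (a, b) (c, d) E"
    then have E: "E \<in> small_ball (j + 3)" by simp
    note S = horizontal_switch[OF E ab cd E']
    have "(perimeter E (j + 2) + 2) * (perimeter E (j + 2) + 2) \<le> (3 * perimeter E (j + 2)) * (3 * perimeter E (j + 2))"
      using pos[OF E] by (intro mult_le_mono) simp_all
    also have "\<dots> = 9 * perimeter E (j + 2) * perimeter E (j + 2)" by simp
    also have "\<dots> \<le> 14 * perimeter E (j + 1) * perimeter E (j + 2)"
      using EH by (intro mult_le_mono1) simp
    finally have "card (boundary E' (B E' (j + 2))) * card (boundary E' (B E' (j + 2)))
        \<le> 14 * perimeter E (j + 1) * perimeter E (j + 2)" using S(6) by simp
    then have "real (card (boundary E' (B E' (j + 2))) * card (boundary E' (B E' (j + 2))))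
        \<le> 14 * real (perimeter E (j + 1)) * real (perimeter E (j + 2))"
      by (metis of_nat_le_iff of_nat_mult of_nat_numeral)
    moreover have "\<omega> E' = \<omega> E" using S(2) by (intro \<omega>(2)) auto
    ultimately show "E' \<in> small_ball (j + 1) \<and> switch (a, c) (b, d) E' = E \<and> \<omega> E' = \<omega> E \<and>
      (a, c) \<in> boundary E' (B E' (j + 2)) \<and> (b, d) \<in> boundary E' (B E' (j + 2)) \<and>
      real (card (boundary E' (B E' (j + 2))) * card (boundary E' (B E' (j + 2))))
        \<le> 14 * real (perimeter E (j + 1)) * real (perimeter E (j + 2))"
      using S(1,3,4,5) by simp
  qed (auto simp: \<omega>(1) horizontal_def boundary_def intro: finE)
  have split: "?slow = ?V \<union> ?H"
  proof -
    have "perimeter E (j + 1) \<le> 12 * card (vertical (j + 1) E) \<or> perimeter E (j + 1) \<le> 12 * card (horizontal (j + 1) E)"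
      if "E \<in> ?slow" for E
      using layer_count[OF small_ballD(1), of E "j + 3" "j + 1"] that by (auto simp: numeral_eq_Suc)
    then show ?thesis by auto
  qed
  have "(\<Sum>E\<in>?slow. \<omega> E / perimeter E (j + 2)) = (\<Sum>E\<in>?V \<union> ?H. \<omega> E / perimeter E (j + 2))"
    using split by (rule arg_cong)
  moreover have "(\<Sum>E\<in>?V \<union> ?H. \<omega> E / perimeter E (j + 2)) + (\<Sum>E\<in>?V \<inter> ?H. \<omega> E / perimeter E (j + 2))
      = (\<Sum>E\<in>?V. \<omega> E / perimeter E (j + 2)) + (\<Sum>E\<in>?H. \<omega> E / perimeter E (j + 2))"
    using finite_small_ball[of "j + 3"] by (intro sum.union_inter) (auto intro: finite_subset)
  moreover have "0 \<le> (\<Sum>E\<in>?V \<inter> ?H. \<omega> E / perimeter E (j + 2))" using \<omega>(1) by (intro sum_nonneg) simp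
  ultimately have "(\<Sum>E\<in>?slow. \<omega> E / perimeter E (j + 2)) \<le> (\<Sum>E\<in>?V. \<omega> E / perimeter E (j + 2)) + (\<Sum>E\<in>?H. \<omega> E / perimeter E (j + 2))"
    by linarith
  also have "\<dots> \<le> (\<Sum>E\<in>small_ball (j + 1). 24 * 3 / arc_total * \<omega> E) + (\<Sum>E\<in>small_ball (j + 1). 24 * 14 / arc_total * \<omega> E)"
    using V H by (rule add_mono)
  also have "\<dots> = 408 / arc_total * (\<Sum>E\<in>small_ball (j + 1). \<omega> E)"
    unfolding sum_distrib_left[symmetric] by (simp add: field_simps)
  finally show ?thesis .
qed

section \<open>Exponential decay\<close>

definition wide_radii :: "nat \<Rightarrow> ('a \<times> 'a) set \<Rightarrow> nat set" where
  "wide_radii t E = {s. s < t \<and> arc_total < wideness * perimeter E s}"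

text \<open>
  The reciprocal of the perimeter turns growth by \<open>3/2\<close> into a loss of \<open>2/3\<close>. The power compensates for
  wide radii, at which slow growth is not rare enough for the reciprocal alone to decrease on average.
\<close>

definition weight :: "nat \<Rightarrow> ('a \<times> 'a) set \<Rightarrow> real" where
  "weight t E = (1 / real wideness) ^ card (wide_radii t E) / perimeter E t"

text \<open>
  At index \<open>t\<close> the sum runs over the graphs in which even the ball of radius \<open>t + 1\<close> is small: arcs that
  avoid that ball can be switched with arcs at distance up to \<open>t\<close> from the root without creating a double edge.
\<close>

definition mass :: "nat \<Rightarrow> real" where
  "mass t = (\<Sum>E\<in>small_ball (t + 1). weight t E)"

lemma finite_wide_radii: "finite (wide_radii t E)"
  by (simp add: wide_radii_def)

lemma wide_radii_mono: "s \<le> t \<Longrightarrow> wide_radii s E \<subseteq> wide_radii t E"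
  by (auto simp: wide_radii_def)

lemma wide_radii_Suc:
  "card (wide_radii (Suc t) E) = (if arc_total < wideness * perimeter E t then Suc else id) (card (wide_radii t E))"
proof -
  have "wide_radii (Suc t) E = (if arc_total < wideness * perimeter E t then insert t else id) (wide_radii t E)"
    by (auto simp: wide_radii_def less_Suc_eq)
  then show ?thesis using finite_wide_radii by (simp add: wide_radii_def)
qed

lemma weight_nonneg: "0 \<le> weight t E"
  by (simp add: weight_def)

lemma power_wide_radii_mono:
  "s \<le> t \<Longrightarrow> (1 / real wideness) ^ card (wide_radii t E) \<le> (1 / real wideness) ^ card (wide_radii s E)"
  by (intro power_decreasing card_mono finite_wide_radii wide_radii_mono) (use wideness_large in auto)

lemma mass_fast_growth:
  "(\<Sum>E | E \<in> small_ball (j + 3) \<and> 3 * perimeter E (j + 1) \<le> 2 * perimeter E (j + 2). weight (j + 2) E)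
    \<le> 2 / 3 * mass (j + 1)"
proof -
  let ?fast = "{E \<in> small_ball (j + 3). 3 * perimeter E (j + 1) \<le> 2 * perimeter E (j + 2)}"
  have sub: "small_ball (j + 3) \<subseteq> small_ball (j + 2)" by (rule small_ball_antimono) simp
  have "(\<Sum>E\<in>?fast. weight (j + 2) E) \<le> (\<Sum>E\<in>?fast. 2 / 3 * weight (j + 1) E)"
  proof (rule sum_mono)
    fix E assume E: "E \<in> ?fast"
    have "0 < perimeter E (j + 1)"
      using perimeter_pos[of E "j + 1"] small_ball_antimono[of "j + 1" "j + 3"] E by auto
    then have "1 / real (perimeter E (j + 2)) \<le> 2 / 3 * (1 / real (perimeter E (j + 1)))"
      using E by (auto simp: field_simps)
    then have "(1 / real wideness) ^ card (wide_radii (j + 2) E) * (1 / real (perimeter E (j + 2)))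
        \<le> (1 / real wideness) ^ card (wide_radii (j + 1) E) * (2 / 3 * (1 / real (perimeter E (j + 1))))"
      by (intro mult_mono power_wide_radii_mono) auto
    then show "weight (j + 2) E \<le> 2 / 3 * weight (j + 1) E"
      by (simp add: weight_def)
  qed
  also have "\<dots> \<le> (\<Sum>E\<in>small_ball (j + 2). 2 / 3 * weight (j + 1) E)"
    using sub weight_nonneg by (intro sum_mono2 finite_small_ball) auto
  finally show ?thesis by (simp add: mass_def sum_distrib_left)
qed

text \<open>
  The bound on slow growth has \<open>1 / arc_total\<close> in place of a weight at radius \<open>j\<close>. If the radius \<open>j\<close> is not wide,
  \<open>1 / arc_total\<close> is at most \<open>1 / wideness\<close> times the reciprocal of the perimeter; if it is wide, the weight itself contains
  a further factor \<open>1 / wideness\<close> for it.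

  The recursion reaches back by two steps because the switched graph is only known to have a small ball
  of radius \<open>j + 1\<close>: the vertex \<open>c\<close> that enters the next ball may have a large degree.
\<close>

lemma mass_slow_growth:
  "(\<Sum>E | E \<in> small_ball (j + 3) \<and> 2 * perimeter E (j + 2) < 3 * perimeter E (j + 1). weight (j + 2) E)
    \<le> 1 / 16 * mass j"
proof -
  let ?slow = "{E \<in> small_ball (j + 3). 2 * perimeter E (j + 2) < 3 * perimeter E (j + 1)}"
  let ?\<omega> = "\<lambda>E. (1 / real wideness) ^ card (wide_radii (j + 1) E)"
  have "(\<Sum>E\<in>?slow. weight (j + 2) E) \<le> (\<Sum>E\<in>?slow. ?\<omega> E / perimeter E (j + 2))"
    unfolding weight_def by (intro sum_mono divide_right_mono power_wide_radii_mono) auto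
  also have "\<dots> \<le> 408 / arc_total * (\<Sum>E\<in>small_ball (j + 1). ?\<omega> E)"
  proof (rule slow_growth_bound)
    fix E E' assume "\<And>t. t \<le> j \<Longrightarrow> perimeter E' t = perimeter E t"
    then have "wide_radii (j + 1) E' = wide_radii (j + 1) E" by (auto simp: wide_radii_def)
    then show "?\<omega> E' = ?\<omega> E" by simp
  qed simp
  also have "\<dots> = (\<Sum>E\<in>small_ball (j + 1). 408 / arc_total * ?\<omega> E)" by (rule sum_distrib_left)
  also have "\<dots> \<le> (\<Sum>E\<in>small_ball (j + 1). 1 / 16 * weight j E)"
  proof (rule sum_mono)
    fix E assume E: "E \<in> small_ball (j + 1)"
    have y: "0 < perimeter E j" using perimeter_pos[of E j] small_ball_antimono[of j "j + 1"] E by auto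
    have yM: "perimeter E j \<le> arc_total" using perimeter_le small_ballD(1)[OF E] .
    define p where "p = (1 / real wideness) ^ card (wide_radii j E)"
    have p: "0 < p" using wideness_large by (simp add: p_def)
    have "408 / arc_total * ?\<omega> E \<le> 1 / 16 * (p / perimeter E j)"
    proof (cases "arc_total < wideness * perimeter E j")
      case True
      then have w: "?\<omega> E = p / real wideness" by (simp add: wide_radii_Suc p_def)
      have "6528 * (p * real (perimeter E j)) \<le> real wideness * (p * real arc_total)"
        using yM p wideness_large by (intro mult_mono) auto
      then show ?thesis unfolding w using y arc_total_pos p wideness_large(2) by (simp add: field_simps)
    next
      case False
      then have w: "?\<omega> E = p" by (simp add: wide_radii_Suc p_def)
      have "6528 * real (perimeter E j) \<le> real wideness * real (perimeter E j)" using wideness_large(1) by (intro mult_right_mono) auto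
      also have "\<dots> \<le> real arc_total" using False by (simp flip: of_nat_mult)
      finally have "p * (6528 * real (perimeter E j)) \<le> p * real arc_total" using p by (intro mult_left_mono) auto
      then show ?thesis unfolding w using y arc_total_pos p by (simp add: field_simps)
    qed
    then show "408 / arc_total * ?\<omega> E \<le> 1 / 16 * weight j E" by (simp add: weight_def p_def)
  qed
  finally show ?thesis by (simp add: mass_def sum_distrib_left)
qed

lemma mass_recursion: "mass (j + 2) \<le> 2 / 3 * mass (j + 1) + 1 / 16 * mass j"
proof -
  have "mass (j + 2) =
      (\<Sum>E | E \<in> small_ball (j + 3) \<and> 3 * perimeter E (j + 1) \<le> 2 * perimeter E (j + 2). weight (j + 2) E) +
      (\<Sum>E | E \<in> small_ball (j + 3) \<and> 2 * perimeter E (j + 2) < 3 * perimeter E (j + 1). weight (j + 2) E)"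
    unfolding mass_def using finite_small_ball[of "j + 3"]
    by (subst sum.union_disjoint[symmetric])
       (auto simp: numeral_eq_Suc intro!: sum.cong intro: finite_subset)
  then show ?thesis using mass_fast_growth[of j] mass_slow_growth[of j] by linarith
qed

lemma mass_le_card: "mass t \<le> card graphs"
proof -
  have "mass t \<le> (\<Sum>E\<in>small_ball (t + 1). 1)"
    unfolding mass_def
  proof (rule sum_mono)
    fix E assume "E \<in> small_ball (t + 1)"
    then have "1 \<le> perimeter E t" using perimeter_pos[of E t] small_ball_antimono[of t "t + 1"] by auto
    moreover have "(1 / real wideness) ^ card (wide_radii t E) \<le> 1" by (rule power_le_one) (use wideness_large in auto)
    ultimately show "weight t E \<le> 1"
      unfolding weight_def by (subst divide_le_eq_1) auto
  qed
  also have "\<dots> \<le> card graphs"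
    using card_mono[OF finite_realisations[OF finite_V], of "small_ball (t + 1)"]
    by (auto simp: small_ball_def)
  finally show ?thesis .
qed

text \<open>
  The rate \<open>3/4\<close> solves \<open>x\<^sup>2 = 2/3 x + 1/16\<close>, the characteristic equation of the recursion.
\<close>

lemma mass_decay: "mass t \<le> 4 / 3 * (3 / 4) ^ t * card graphs"
proof (induction t rule: less_induct)
  case (less t)
  consider "t = 0" | "t = 1" | j where "t = j + 2"
    by (metis One_nat_def add_2_eq_Suc' not0_implies_Suc)
  then show ?case
  proof cases
    case (3 j)
    have "mass t \<le> 2 / 3 * mass (j + 1) + 1 / 16 * mass j" using mass_recursion 3 by simp
    also have "\<dots> \<le> 2 / 3 * (4 / 3 * (3 / 4) ^ (j + 1) * card graphs)
        + 1 / 16 * (4 / 3 * (3 / 4) ^ j * card graphs)"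
      using less.IH[of j] less.IH[of "j + 1"] 3 by (intro add_mono mult_left_mono) auto
    also have "\<dots> = 4 / 3 * (3 / 4) ^ t * card graphs" by (simp add: 3 field_simps)
    finally show ?thesis .
  qed (use mass_le_card[of t] in auto)
qed

text \<open>
  The boundaries of different balls are disjoint, so the perimeters add up to at most the number of arcs.
\<close>

lemma card_wide_radii:
  assumes E: "E \<in> graphs" shows "card (wide_radii t E) \<le> wideness"
proof -
  let ?W = "wide_radii t E"
  have disj: "boundary E (B E s) \<inter> boundary E (B E s') = {}" if "s < s'" for s s'
    using neighbour_in_ball_of[of _ E u s] ball_of_mono[of "Suc s" s' E u] that
    by (fastforce simp: boundary_def)
  have "(\<Sum>s\<in>?W. perimeter E s) = card (\<Union>s\<in>?W. boundary E (B E s))"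
    unfolding perimeter_def
  proof (rule card_UN_disjoint[symmetric])
    show "\<forall>s\<in>?W. \<forall>s'\<in>?W. s \<noteq> s' \<longrightarrow> boundary E (B E s) \<inter> boundary E (B E s') = {}"
      using disj by (metis Int_commute linorder_neqE_nat)
  qed (use finite_wide_radii finite_boundary[OF E] in auto)
  also have "\<dots> \<le> card E" using finE[OF E] by (intro card_mono) (auto simp: boundary_def)
  finally have "(\<Sum>s\<in>?W. perimeter E s) \<le> arc_total" using card_arcs[OF E] by simp
  moreover have "card ?W * arc_total \<le> (\<Sum>s\<in>?W. wideness * perimeter E s)"
    by (rule sum_bounded_below[of ?W arc_total, simplified]) (auto simp: wide_radii_def)
  moreover have "(\<Sum>s\<in>?W. wideness * perimeter E s) = wideness * (\<Sum>s\<in>?W. perimeter E s)" by (rule sum_distrib_left[symmetric])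
  ultimately have "card ?W * arc_total \<le> wideness * arc_total"
    using mult_le_mono2[of "\<Sum>s\<in>?W. perimeter E s" arc_total wideness] by linarith
  then show ?thesis using arc_total_pos by simp
qed

text \<open>
  At most \<open>wideness\<close> radii are wide, so every graph weighs at least
  \<open>wideness\<close> to the power \<open>- wideness\<close>, divided by the number of arcs.
\<close>

lemma card_small_ball:
  "card (small_ball (t + 1)) \<le> 4 / 3 * real wideness ^ wideness * arc_total * (3 / 4) ^ t * card graphs"
proof -
  let ?c = "real wideness ^ wideness :: real"
  have c: "0 < ?c" using wideness_large by simp
  have "real (card (small_ball (t + 1))) * ((1 / real wideness) ^ wideness / arc_total) \<le> mass t"
    unfolding mass_def
  proof (rule sum_bounded_below)
    fix E assume E: "E \<in> small_ball (t + 1)"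
    then have "0 < perimeter E t" using perimeter_pos[of E t] small_ball_antimono[of t "t + 1"] by auto
    then show "(1 / real wideness) ^ wideness / arc_total \<le> weight t E"
      unfolding weight_def
      using card_wide_radii[OF small_ballD(1)[OF E]] perimeter_le[OF small_ballD(1)[OF E]] wideness_large
      by (intro frac_le power_decreasing) auto
  qed
  also have "\<dots> \<le> 4 / 3 * (3 / 4) ^ t * card graphs" by (rule mass_decay)
  finally have "real (card (small_ball (t + 1))) \<le> 4 / 3 * (3 / 4) ^ t * card graphs * (arc_total * ?c)"
    using c arc_total_pos unfolding power_one_over by (simp add: field_simps)
  then show ?thesis by (simp only: mult_ac)
qed

end

section \<open>The random graph\<close>

lemma out_degree_with_proj: "out_degree (with_proj G) v = card (parcs G `` {v})"
proof -
  have "out_arcs (with_proj G) v = Pair v ` (parcs G `` {v})"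
    by (auto simp: out_arcs_def)
  then show ?thesis by (simp add: out_degree_def card_image inj_on_def)
qed

text \<open>
  For \<open>n = 0\<close> the empty arc set would be a realisation, whereas the graph without vertices does not count
  as connected.
\<close>

lemma bij_betw_parcs_connected_graphs:
  assumes "0 < n"
  shows "bij_betw parcs (connected_graphs n d) (realisations {1..n} d)"
proof (rule bij_betw_imageI)
  show "inj_on parcs (connected_graphs n d)"
    by (rule inj_onI) (simp add: connected_graphs_def)
  show "parcs ` connected_graphs n d = realisations {1..n} d"
  proof (intro equalityI subsetI)
    fix E assume "E \<in> parcs ` connected_graphs n d"
    then obtain G where E: "E = parcs G" and G: "G \<in> connected_graphs n d" by auto
    interpret pair_graph G using G by (simp add: connected_graphs_def)
    have V: "pverts G = {1..n}" using G by (simp add: connected_graphs_def)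
    have reach: "x \<rightarrow>\<^sup>*\<^bsub>with_proj G\<^esub> z" if "x \<in> {1..n}" "z \<in> {1..n}" for x z
      using G that V reachable_mk_symmetric_eq[OF pair_sym_arcs]
      by (auto simp: connected_graphs_def connected_def strongly_connected_def mk_symmetric_def)
    have "\<forall>x\<in>{1..n}. \<forall>z\<in>{1..n}. (x, z) \<in> E\<^sup>*"
    proof (intro ballI)
      fix x z assume "x \<in> {1..n}" "z \<in> {1..n}"
      then show "(x, z) \<in> E\<^sup>*" using reachable_rtranclI[OF reach[of x z]] E by simp
    qed
    moreover have "sym E" "E \<subseteq> {1..n} \<times> {1..n}"
      using pair_sym_arcs in_arcsD1 in_arcsD2 V E by (auto simp: symmetric_def)
    moreover have "irrefl E" using pair_no_loops E by (force simp: irrefl_def)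
    ultimately show "E \<in> realisations {1..n} d"
      using G E by (simp add: realisations_def connected_graphs_def out_degree_with_proj)
  next
    fix E assume E: "E \<in> realisations {1..n} d"
    note D = realisationsD[OF E]
    define G where "G = \<lparr>pverts = {1..n}, parcs = E\<rparr>"
    interpret pair_graph G
      using D(1-3) finite_realisation[OF _ E]
      by unfold_locales (auto simp: G_def symmetric_def irrefl_def)
    have "x \<rightarrow>\<^sup>*\<^bsub>with_proj G\<^esub> z" if "x \<in> {1..n}" "(x, z) \<in> E\<^sup>*" for x z
      using that(2)
    proof (induction rule: rtrancl_induct)
      case base
      show ?case by (rule reachable_refl) (simp add: G_def that(1)[simplified])
    next
      case (step z z')
      then show ?case by (intro reachable_adj_trans[of x z z']) (auto simp: G_def)
    qed
    then have "Digraph_Component.connected (with_proj G)"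
      using D(5) assms reachable_mk_symmetric_eq[OF pair_sym_arcs]
      by (auto simp: connected_def strongly_connected_def mk_symmetric_def G_def)
    then have "G \<in> connected_graphs n d"
      using D(4) pair_graph by (simp add: connected_graphs_def G_def out_degree_with_proj)
    then show "E \<in> parcs ` connected_graphs n d" by (force simp: G_def)
  qed
qed

context pair_graph
begin

lemma awalk_of_ball_of:
  assumes "x \<in> pverts G" "z \<in> ball_of (parcs G) x k"
  shows "\<exists>p. awalk x p z \<and> length p \<le> k"
  using assms(2)
proof (induction k arbitrary: z)
  case 0
  then show ?case using assms(1) by (auto simp: awalk_Nil_iff intro!: exI[of _ "[]"])
next
  case (Suc k)
  show ?case
  proof (cases "z \<in> ball_of (parcs G) x k")
    case True
    then show ?thesis using Suc.IH[of z] by (auto intro: le_SucI)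
  next
    case False
    then obtain w where w: "w \<in> ball_of (parcs G) x k" "(w, z) \<in> parcs G"
      using Suc.prems by (auto simp: ball_of_Suc)
    obtain p where p: "awalk x p w" "length p \<le> k" using Suc.IH[OF w(1)] by auto
    have "awalk x (p @ [(w, z)]) z"
      using awalk_appendI[OF p(1)] arc_implies_awalk[OF w(2)] by simp
    then show ?thesis using p(2) by (intro exI[of _ "p @ [(w, z)]"]) simp
  qed
qed

lemma apath_of_awalk: "awalk x p z \<Longrightarrow> \<exists>q. apath x q z \<and> length q \<le> length p"
proof (induction rule: awalk_to_apath_induct)
  case (path p)
  then show ?case by (auto simp: apath_def)
next
  case (decomp p q r s)
  then have "p = q @ r @ s" by (auto elim!: awalk_cyc_decompE)
  with decomp show ?case by (auto intro: order_trans)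
qed

lemma graph_dist_le_of_ball_of:
  assumes "x \<in> pverts G" "z \<in> ball_of (parcs G) x k"
  shows "graph_dist G x z \<le> k"
proof -
  obtain p where "awalk x p z" "length p \<le> k" using awalk_of_ball_of[OF assms] by auto
  then obtain q where "apath x q z" "length q \<le> k" using apath_of_awalk by (meson order_trans)
  then have "graph_dist G x z \<le> length q" unfolding graph_dist_def by (intro Least_le) blast
  then show ?thesis using \<open>length q \<le> k\<close> by (rule order_trans)
qed

lemma graph_dist_le_card:
  assumes "x \<rightarrow>\<^sup>*\<^bsub>with_proj G\<^esub> z"
  shows "graph_dist G x z \<le> card (pverts G)"
proof -
  obtain p where p: "apath x p z" using assms reachable_apath by auto
  then have "graph_dist G x z \<le> length p" unfolding graph_dist_def by (intro Least_le) blast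
  also have "length p \<le> card (pverts G)" using p by (rule length_apath)
  finally show ?thesis .
qed

end

lemma graph_diam_le:
  assumes "finite (pverts G)" "pverts G \<noteq> {}"
    "\<And>x z. x \<in> pverts G \<Longrightarrow> z \<in> pverts G \<Longrightarrow> graph_dist G x z \<le> k"
  shows "graph_diam G \<le> k"
proof -
  have "{graph_dist G u v | u v. u \<in> pverts G \<and> v \<in> pverts G}
      = (\<lambda>(u, v). graph_dist G u v) ` (pverts G \<times> pverts G)" by auto
  then show ?thesis unfolding graph_diam_def using assms by (auto intro!: Max.boundedI)
qed

text \<open>
  Two distant balls are touched by disjoint sets of arcs, so one of them is touched by at most half of the arcs.
\<close>

lemma one_ball_is_small:
  assumes E: "sym E" "finite E" and far: "z \<notin> ball_of E x (2 * t + 1)"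
  shows "card E \<le> 2 * card (avoiding E (ball_of E x t)) \<or> card E \<le> 2 * card (avoiding E (ball_of E z t))"
proof -
  let ?X = "ball_of E x t" and ?Z = "ball_of E z t"
  have disj: "b \<notin> ?Z" if "a \<in> ?X" "b = a \<or> (a, b) \<in> E" for a b
  proof
    assume "b \<in> ?Z"
    then have "z \<in> ball_of E b t" by (rule ball_of_sym[OF E(1)])
    moreover have "b \<in> ball_of E x (t + 1)"
      using that neighbour_in_ball_of[of a E x t b] ball_of_mono[of t "t + 1" E x] by auto
    ultimately have "z \<in> ball_of E x (t + 1 + t)" by (rule ball_of_trans[rotated])
    then show False using far by (simp add: mult_2)
  qed
  have "E \<subseteq> avoiding E ?X \<union> avoiding E ?Z"
  proof (rule subrelI)
    fix a b assume ab: "(a, b) \<in> E"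
    then have "(b, a) \<in> E" using E(1) by (rule symD[rotated])
    then show "(a, b) \<in> avoiding E ?X \<union> avoiding E ?Z"
      using ab disj[of a a] disj[of a b] disj[of b b] disj[of b a] by (auto simp: avoiding_def)
  qed
  then have "card E \<le> card (avoiding E ?X \<union> avoiding E ?Z)"
    using E(2) by (intro card_mono) (auto simp: avoiding_def)
  also have "\<dots> \<le> card (avoiding E ?X) + card (avoiding E ?Z)" by (rule card_Un_le)
  finally show ?thesis by linarith
qed

text \<open>
  A union bound over the root gives one factor \<open>n\<close>, and \<open>n\<^sup>2\<close> bounds the number of arcs.
\<close>

lemma card_large_diameter:
  assumes deg: "\<And>v. v \<in> {1..n} \<Longrightarrow> 3 \<le> d v" and n: "0 < n"
  shows "real (card {G \<in> connected_graphs n d. 2 * t + 3 < graph_diam G})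
    \<le> 4 / 3 * real wideness ^ wideness * real n ^ 3 * (3 / 4) ^ t * card (connected_graphs n d)"
proof -
  let ?C = "connected_graphs n d" and ?V = "{1..n}"
  let ?S = "\<lambda>u. rooted_realisations.small_ball ?V d u (t + 1)"
  note bij = bij_betw_parcs_connected_graphs[OF n, of d]
  have loc: "rooted_realisations ?V d u" if "u \<in> ?V" for u
    using deg that by unfold_locales auto
  have sub: "parcs ` {G \<in> ?C. 2 * t + 3 < graph_diam G} \<subseteq> (\<Union>u\<in>?V. ?S u)"
  proof (rule image_subsetI)
    fix G assume "G \<in> {G \<in> ?C. 2 * t + 3 < graph_diam G}"
    then have G: "G \<in> ?C" and diam: "2 * t + 3 < graph_diam G" by auto
    interpret pair_graph G using G by (simp add: connected_graphs_def)
    have V: "pverts G = ?V" using G by (simp add: connected_graphs_def)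
    have R: "parcs G \<in> realisations ?V d" using bij G by (auto dest: bij_betwE)
    obtain x z where x: "x \<in> ?V" and z: "z \<in> ?V" and "2 * t + 3 < graph_dist G x z"
      using graph_diam_le[of G "2 * t + 3"] diam V n by fastforce
    then have "z \<notin> ball_of (parcs G) x (2 * t + 3)"
      using graph_dist_le_of_ball_of[of x z "2 * t + 3"] V by auto
    moreover have "2 * t + 3 = 2 * (t + 1) + 1" by simp
    ultimately have far: "z \<notin> ball_of (parcs G) x (2 * (t + 1) + 1)" by metis
    have "parcs G \<in> ?S w"
      if "w \<in> ?V" "card (parcs G) \<le> 2 * card (avoiding (parcs G) (ball_of (parcs G) w (t + 1)))" for w
      using that(2) R
      unfolding rooted_realisations.small_ball_def[OF loc[OF that(1)]]
        rooted_realisations.card_arcs[OF loc[OF that(1)] R] by blast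
    then show "parcs G \<in> (\<Union>u\<in>?V. ?S u)"
      using one_ball_is_small[OF realisationsD(2)[OF R] finite_realisation[OF _ R] far] x z by blast
  qed
  have "card {G \<in> ?C. 2 * t + 3 < graph_diam G} = card (parcs ` {G \<in> ?C. 2 * t + 3 < graph_diam G})"
    using bij by (intro card_image[symmetric]) (auto simp: bij_betw_def intro: inj_on_subset)
  also have "\<dots> \<le> card (\<Union>u\<in>?V. ?S u)"
    using rooted_realisations.finite_small_ball[OF loc] by (intro card_mono sub finite_UN_I) simp_all
  also have "\<dots> \<le> (\<Sum>u\<in>?V. card (?S u))" by (rule card_UN_le) simp
  finally have "real (card {G \<in> ?C. 2 * t + 3 < graph_diam G}) \<le> (\<Sum>u\<in>?V. real (card (?S u)))"
    by (simp flip: of_nat_sum)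
  also have "\<dots> \<le> (\<Sum>u\<in>?V. 4 / 3 * real wideness ^ wideness * real n ^ 2 * (3 / 4) ^ t * card ?C)"
  proof (cases "?C = {}")
    case True
    then have "realisations ?V d = {}" using bij by (auto simp: bij_betw_def)
    then show ?thesis using loc by (auto intro!: sum_mono simp: rooted_realisations.small_ball_def True)
  next
    case False
    then obtain E where E: "E \<in> realisations ?V d" using bij by (auto dest: bij_betwE)
    show ?thesis
    proof (rule sum_mono)
      fix u assume u: "u \<in> ?V"
      interpret rooted_realisations ?V d u by (rule loc[OF u])
      \<comment> \<open>In a simple graph the degree sum is at most \<open>n\<^sup>2\<close>.\<close>
      have "arc_total = card E" by (rule card_arcs[OF E, symmetric])
      also have "\<dots> \<le> card (?V \<times> ?V)" by (intro card_mono realisationsD(1)[OF E]) simp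
      also have "\<dots> = n ^ 2" by (simp add: power2_eq_square)
      finally have "real arc_total \<le> real n ^ 2" by (simp flip: of_nat_power)
      then have "4 / 3 * real wideness ^ wideness * arc_total * (3 / 4) ^ t * card graphs
          \<le> 4 / 3 * real wideness ^ wideness * real n ^ 2 * (3 / 4) ^ t * card graphs"
        by (intro mult_right_mono mult_left_mono) auto
      then show "real (card (small_ball (t + 1))) \<le> 4 / 3 * real wideness ^ wideness * real n ^ 2 * (3 / 4) ^ t * card ?C"
        using order_trans[OF card_small_ball[of t]] unfolding bij_betw_same_card[OF bij] by blast
    qed
  qed
  also have "\<dots> = 4 / 3 * real wideness ^ wideness * real n ^ 3 * (3 / 4) ^ t * card ?C"
    by (simp add: power3_eq_cube power2_eq_square)
  finally show ?thesis .
qed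

lemma expected_diameter_le:
  assumes deg: "\<And>v. v \<in> {1..n} \<Longrightarrow> 3 \<le> d v" and n: "0 < n" and ne: "connected_graphs n d \<noteq> {}"
  shows "measure_pmf.expectation (pmf_of_set (connected_graphs n d)) (\<lambda>G. real (graph_diam G))
    \<le> 2 * t + 3 + 4 / 3 * real wideness ^ wideness * real n ^ 4 * (3 / 4) ^ t"
proof -
  let ?C = "connected_graphs n d"
  let ?bad = "{G \<in> ?C. 2 * t + 3 < graph_diam G}"
  have fin: "finite ?C" by (rule finite_connected_graphs)
  have card: "0 < card ?C" using fin ne by (simp add: card_gt_0_iff)
  have le_n: "graph_diam G \<le> n" if G: "G \<in> ?C" for G
  proof -
    interpret pair_graph G using G by (simp add: connected_graphs_def)
    have V: "pverts G = {1..n}" using G by (simp add: connected_graphs_def)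
    have "x \<rightarrow>\<^sup>*\<^bsub>with_proj G\<^esub> z" if "x \<in> {1..n}" "z \<in> {1..n}" for x z
      using G that V reachable_mk_symmetric_eq[OF pair_sym_arcs]
      by (auto simp: connected_graphs_def connected_def strongly_connected_def mk_symmetric_def)
    then show ?thesis using graph_dist_le_card V n by (intro graph_diam_le) fastforce+
  qed
  have "(\<Sum>G\<in>?C. real (graph_diam G)) \<le> (\<Sum>G\<in>?C. real (2 * t + 3) + (if G \<in> ?bad then real n else 0))"
    using le_n by (intro sum_mono) (auto simp: add_increasing)
  also have "\<dots> = real (2 * t + 3) * card ?C + real n * card ?bad"
    using fin by (simp add: sum.distrib flip: sum.inter_filter)
  also have "real n * card ?bad \<le> n * (4 / 3 * real wideness ^ wideness * real n ^ 3 * (3 / 4) ^ t * card ?C)"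
    by (intro mult_left_mono card_large_diameter deg n) simp_all
  also have "real (2 * t + 3) * card ?C + n * (4 / 3 * real wideness ^ wideness * real n ^ 3 * (3 / 4) ^ t * card ?C)
      = (2 * t + 3 + 4 / 3 * real wideness ^ wideness * real n ^ 4 * (3 / 4) ^ t) * card ?C"
    by (simp add: algebra_simps power4_eq_xxxx power3_eq_cube)
  finally show ?thesis
    using card by (subst integral_pmf_of_set[OF ne fin]) (simp add: pos_divide_le_eq)
qed

theorem corollary1p6:
  shows "\<exists>C::real. C > 0 \<and>
    (\<forall>(n::nat) (d::nat \<Rightarrow> nat).
       degree_sequence n d \<and> num_deg 1 n d = 0 \<and> num_deg 2 n d = 0 \<and>
       connected_graphs n d \<noteq> {} \<longrightarrow>
       measure_pmf.expectation (pmf_of_set (connected_graphs n d)) (\<lambda>G. real (graph_diam G))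
         \<le> C * ln (real n))"
proof -
  define c where "c = 4 / 3 * real wideness ^ wideness"
  define l where "l = ln (4 / 3 :: real)"
  define C where "C = 8 / l + (5 + c) / ln 2"
  have c: "0 \<le> c" by (simp add: c_def)
  have l: "0 < l" by (simp add: l_def)
  have "0 < C" unfolding C_def using c l by (intro add_pos_pos divide_pos_pos add_pos_nonneg) simp_all
  moreover have "measure_pmf.expectation (pmf_of_set (connected_graphs n d)) (\<lambda>G. real (graph_diam G))
      \<le> C * ln (real n)"
    if seq: "degree_sequence n d" and n12: "num_deg 1 n d = 0" "num_deg 2 n d = 0"
      and ne: "connected_graphs n d \<noteq> {}" for n d
  proof -
    have deg: "3 \<le> d v" if "v \<in> {1..n}" for v
    proof -
      have "d v \<noteq> 0" using seq that by (auto simp: degree_sequence_def)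
      moreover have "d v \<noteq> 1" "d v \<noteq> 2" using n12 that by (auto simp: num_deg_def)
      ultimately show ?thesis by linarith
    qed
    obtain G where G: "G \<in> connected_graphs n d" using ne by blast
    have n0: "0 < n"
      using G by (auto simp: connected_graphs_def connected_def strongly_connected_def mk_symmetric_def)
    have R: "parcs G \<in> realisations {1..n} d"
      using bij_betw_parcs_connected_graphs[OF n0] G by (auto dest: bij_betwE)
    have "3 \<le> card (parcs G `` {1})" using realisationsD(4)[OF R, of 1] deg[of 1] n0 by simp
    also have "\<dots> \<le> card {1..n}" using realisationsD(1)[OF R] by (intro card_mono) auto
    finally have n3: "3 \<le> n" by simp
    \<comment> \<open>This makes \<open>(3/4)\<^sup>t\<close> cancel the factor \<open>n\<^sup>4\<close> in the bound for the expectation.\<close>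
    define t where "t = nat \<lceil>4 * ln n / l\<rceil>"
    have t: "4 * ln n / l \<le> t" "t \<le> 4 * ln n / l + 1"
      using l n3 unfolding t_def by (auto simp: nat_ceiling_le_eq)
    have "(3 / 4 :: real) ^ t * n ^ 4 \<le> 1"
    proof -
      have "ln (real n ^ 4) = 4 * ln n" using n3 by (simp add: ln_realpow)
      also have "\<dots> \<le> t * l" using t(1) l by (simp add: pos_divide_le_eq)
      also have "\<dots> = ln ((4 / 3) ^ t)" by (simp add: ln_realpow l_def)
      finally have "real n ^ 4 \<le> (4 / 3) ^ t" using n3 by (subst (asm) ln_le_cancel_iff) auto
      then have "(3 / 4 :: real) ^ t * real n ^ 4 \<le> (3 / 4) ^ t * (4 / 3) ^ t" by (intro mult_left_mono) auto
      then show ?thesis by (simp flip: power_mult_distrib)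
    qed
    then have tail: "c * real n ^ 4 * (3 / 4) ^ t \<le> c"
      using mult_left_mono[OF _ c] by (fastforce simp: mult_ac)
    have "ln 2 \<le> ln (real n)" using n3 by simp
    then have "(5 + c) * 1 \<le> (5 + c) * (ln n / ln 2)" using c by (intro mult_left_mono) auto
    then have const: "5 + c \<le> (5 + c) * (ln n / ln 2)" by simp
    have "measure_pmf.expectation (pmf_of_set (connected_graphs n d)) (\<lambda>G. real (graph_diam G))
        \<le> 2 * real t + 3 + c * real n ^ 4 * (3 / 4) ^ t"
      using expected_diameter_le[of n d t, OF deg n0 ne] by (simp add: c_def)
    also have "\<dots> \<le> 2 * (4 * ln n / l) + (5 + c) * (ln n / ln 2)"
      using tail const t(2) by linarith
    also have "\<dots> = C * ln n" by (simp add: C_def algebra_simps)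
    finally show ?thesis .
  qed
  ultimately show ?thesis by blast
qed

end
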